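(* Let $\mathbb{F}$ be a finite field and let $C_X, C_Z\subseteq\mathbb{F}^n$ be linear codes such that $C_X^\perp$ and $C_Z^\perp$ are orthogonal, i.e. $\langle c,c'\rangle=0$ for all $c\in C_X^\perp$ and $c'\in C_Z^\perp$ (so $(C_X,C_Z)$ is a CSS code). Let $k=\dim(C_X)$ and $k'=k-\dim(C_Z^\perp)$, and assume $k'<k$. Let $C=C_X$, let $G\in\mathbb{F}^{n\times k}$ be a generator matrix for $C$ whose last $k-k'$ columns form a basis for $C_Z^\perp$ (such a $G$ exists since $C_Z^\perp\subseteq C_X$), and let $\mathrm{Enc}:\mathbb{F}^{k'}\to C$ be the $k'$-randomized encoding map for $G$. Let $d_X$ be the smallest weight of a vector in $C_X\setminus C_Z^\perp$ and $d_Z$ the smallest weight of a vector in $C_Z\setminus C_X^\perp$. Then the following hold: 1. For every non-negative integer $e$: $d_X>2e$ if and only if $\mathrm{Enc}$ is decodable from $e$ errors. 2. For every non-negative integer $t<n$: $d_Z>t$ if and only if $\mathrm{Enc}$ is $t$-ZK.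
   Context: For $u,v\in\mathbb{F}^n$, $\langle u,v\rangle=\sum_{i=1}^n u_iv_i$, and the weight $\mathrm{wt}(u)$ is the number of non-zero coordinates of $u$. A linear code is a linear subspace $C\subseteq\mathbb{F}^n$; its dual is $C^\perp=\{c'\in\mathbb{F}^n: \langle c',c\rangle=0 \text{ for all } c\in C\}$. A generator matrix for a linear code $C$ of dimension $k$ is a full-rank matrix $G\in\mathbb{F}^{n\times k}$ whose image (column span) is $C$. Randomized encoding map: for $k'<k$, the $k'$-randomized encoding map for $G$ is the random map $\mathrm{Enc}:\mathbb{F}^{k'}\to C$ which on input $m\in\mathbb{F}^{k'}$ samples a uniformly random $r\in\mathbb{F}^{k-k'}$ and outputs $G\cdot z$, where $z=(m,r)\in\mathbb{F}^k$ (the first $k'$ entries of $z$ are $m$ and the last $k-k'$ entries are $r$). $t$-ZK: for $t<n$, $\mathrm{Enc}$ is $t$-Zero-Knowledge ($t$-ZK) if for every $I\subseteq[n]=\{1,\dots,n\}$ of size $t$ and every pair of messages $m,m'\in\mathbb{F}^{k'}$, the restrictions $\mathrm{Enc}(m)|_I$ and $\mathrm{Enc}(m')|_I$ to the coordinates in $I$ are identically distributed. Decodability: $\mathrm{Enc}$ is decodable from $e$ errors if there is a deterministic (not necessarily efficient) algorithm $D$, i.e. a function $D:\mathbb{F}^n\to\mathbb{F}^{k'}$, such that for every $m\in\mathbb{F}^{k'}$ and every $y\in\mathbb{F}^n$ with $\mathrm{wt}(y)\le e$ one has $\Pr[D(\mathrm{Enc}(m)+y)=m]=1$. Convention: the minimum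 weight over an empty set is $+\infty$ (relevant only when $k'=0$). *)

theory Defs
  imports
    "HOL-Probability.Probability_Mass_Function"
    "Jordan_Normal_Form.DL_Rank"
begin

(* HOL-Analysis and Jordan_Normal_Form both declare a type vec and the syntax v $ i; below they
   always mean the vectors and matrices of Jordan_Normal_Form. *)
hide_type (open) Finite_Cartesian_Product.vec
hide_const (open) Finite_Cartesian_Product.vec Finite_Cartesian_Product.mat
unbundle no vec_syntax
unbundle no inner_syntax

definition linear_code :: "nat \<Rightarrow> 'a::field vec set \<Rightarrow> bool" where
  "linear_code n C \<longleftrightarrow> VectorSpace.subspace class_ring C (module_vec TYPE('a) n)"

abbreviation code_space :: "nat \<Rightarrow> 'a::field vec set \<Rightarrow> ('a, 'a vec) module" where
  "code_space n C \<equiv> (module_vec TYPE('a) n)\<lparr>carrier := C\<rparr>"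

definition code_dim :: "nat \<Rightarrow> 'a::field vec set \<Rightarrow> nat" where
  "code_dim n C = vectorspace.dim class_ring (code_space n C)"

definition dual_code :: "nat \<Rightarrow> 'a::field vec set \<Rightarrow> 'a vec set" where
  "dual_code n C = {c' \<in> carrier_vec n. \<forall>c\<in>C. c' \<bullet> c = 0}"

definition wt :: "'a::zero vec \<Rightarrow> nat" where
  "wt v = card {i. i < dim_vec v \<and> v $ i \<noteq> 0}"

(* The infimum in enat is attained on nonempty sets and equals \<infinity> on the empty set. *)
definition min_weight :: "'a::zero vec set \<Rightarrow> enat" where
  "min_weight S = (INF v\<in>S. enat (wt v))"

definition generator_matrix :: "nat \<Rightarrow> 'a::field vec set \<Rightarrow> 'a mat \<Rightarrow> bool" where
  "generator_matrix n C G \<longleftrightarrow>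
     G \<in> carrier_mat n (code_dim n C) \<and>
     vec_space.rank n G = code_dim n C \<and>
     vec_space.col_space n G = C"

definition is_basis_list :: "nat \<Rightarrow> 'a::field vec set \<Rightarrow> 'a vec list \<Rightarrow> bool" where
  "is_basis_list n W vs \<longleftrightarrow> distinct vs \<and> vectorspace.basis class_ring (code_space n W) (set vs)"

definition rand_enc :: "nat \<Rightarrow> 'a::{field,finite} mat \<Rightarrow> 'a vec \<Rightarrow> 'a vec pmf" where
  "rand_enc k' G m =
     map_pmf (\<lambda>r. G *\<^sub>v (m @\<^sub>v r)) (pmf_of_set (carrier_vec (dim_col G - k')))"

(* Coordinates are indexed by {..<n} rather than {1..n}; restrict v|_I is the function
   i \<mapsto> v $ i on I, undefined outside I. *)
definition zero_knowledge ::
  "nat \<Rightarrow> nat \<Rightarrow> nat \<Rightarrow> ('a vec \<Rightarrow> 'a vec pmf) \<Rightarrow> bool" where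
  "zero_knowledge n k' t Enc \<longleftrightarrow>
     (\<forall>I. I \<subseteq> {..<n} \<and> card I = t \<longrightarrow>
       (\<forall>m\<in>carrier_vec k'. \<forall>m'\<in>carrier_vec k'.
          map_pmf (\<lambda>c. restrict (\<lambda>i. c $ i) I) (Enc m) =
          map_pmf (\<lambda>c. restrict (\<lambda>i. c $ i) I) (Enc m')))"

definition decodable ::
  "nat \<Rightarrow> nat \<Rightarrow> nat \<Rightarrow> ('a::{zero,plus} vec \<Rightarrow> 'a vec pmf) \<Rightarrow> bool" where
  "decodable n k' e Enc \<longleftrightarrow>
     (\<exists>D \<in> carrier_vec n \<rightarrow> carrier_vec k'.
       \<forall>m\<in>carrier_vec k'. \<forall>y\<in>carrier_vec n. wt y \<le> e \<longrightarrow>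
         measure_pmf.prob (Enc m) {c. D (c + y) = m} = 1)"

end

theory Submission
  imports Defs
begin

text \<open>Split \<open>G\<close> into its first \<open>k'\<close> columns \<open>A\<close> and its last columns \<open>B\<close>: encodings of \<open>m\<close>
  are uniform on the coset \<open>A m + C\<^sub>Z\<^sup>\<bottom>\<close>, and distinct messages give distinct cosets. The
  differences of encodings of distinct messages are thus exactly the elements of \<open>C\<^sub>X - C\<^sub>Z\<^sup>\<bottom>\<close>, and
  unique decoding from \<open>e\<close> errors fails iff such a difference is a difference of two vectors of
  weight at most \<open>e\<close>. On coordinates \<open>I\<close>, the encodings of all messages are identically distributed
  iff \<open>C\<^sub>X\<close> and \<open>C\<^sub>Z\<^sup>\<bottom>\<close> have the same restriction to \<open>I\<close>; otherwise a linear functional on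
  \<open>F\<^sup>I\<close> vanishes on the smaller restriction but not on the larger one, and this functional is a vector
  of \<open>C\<^sub>Z\<^sup>\<bottom>\<^sup>\<bottom> - C\<^sub>X\<^sup>\<bottom> = C\<^sub>Z - C\<^sub>X\<^sup>\<bottom>\<close> supported on \<open>I\<close>.\<close>

section \<open>Linear codes and their duals\<close>

lemma finite_carrier_vec: "finite (carrier_vec n :: 'a::finite vec set)"
proof (rule finite_subset)
  show "carrier_vec n \<subseteq> vec_of_list ` {xs :: 'a list. set xs \<subseteq> UNIV \<and> length xs = n}"
  proof
    fix v :: "'a vec"
    assume "v \<in> carrier_vec n"
    then have "v = vec_of_list (list_of_vec v)" "length (list_of_vec v) = n"
      by (auto simp: vec_list)
    then show "v \<in> vec_of_list ` {xs :: 'a list. set xs \<subseteq> UNIV \<and> length xs = n}" by blast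
  qed
qed (intro finite_imageI finite_lists_length_eq, simp)

lemma linear_code_iff:
  fixes V :: "'a::field vec set"
  shows "linear_code n V \<longleftrightarrow>
    V \<subseteq> carrier_vec n \<and> 0\<^sub>v n \<in> V \<and> (\<forall>u\<in>V. \<forall>v\<in>V. u + v \<in> V) \<and> (\<forall>a. \<forall>v\<in>V. a \<cdot>\<^sub>v v \<in> V)"
  unfolding linear_code_def subspace_def submodule_def
  using vec_vs[where 'a='a and n=n] vec_module[where 'a='a and n=n]
  by (auto simp: module_vec_simps class_ring_simps)

lemma linear_code_minus:
  fixes V :: "'a::field vec set"
  assumes "linear_code n V" "u \<in> V" "v \<in> V"
  shows "u - v \<in> V"
proof -
  have "u + (-1) \<cdot>\<^sub>v v \<in> V" using assms unfolding linear_code_iff by blast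
  moreover have "u + (-1) \<cdot>\<^sub>v v = u - v"
    using assms unfolding linear_code_iff by (intro eq_vecI) auto
  ultimately show ?thesis by simp
qed

lemma linear_code_dual_code:
  fixes C :: "'a::field vec set"
  assumes "C \<subseteq> carrier_vec n"
  shows "linear_code n (dual_code n C)"
  unfolding linear_code_iff dual_code_def
proof (intro conjI ballI allI)
  show "0\<^sub>v n \<in> {c' \<in> carrier_vec n. \<forall>c\<in>C. c' \<bullet> c = 0}" using assms by auto
qed (use assms in \<open>auto simp: add_scalar_prod_distrib[of _ n] subset_iff\<close>)

text \<open>A subspace that is maximal among those containing \<open>V\<close> but not \<open>x\<close> is a hyperplane
  complementary to \<open>x\<close>, and the coordinate along \<open>x\<close> is the required functional.\<close>

lemma dual_code_separates:
  fixes V :: "'a::{field,finite} vec set"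
  assumes V: "linear_code n V" and x: "x \<in> carrier_vec n" "x \<notin> V"
  shows "\<exists>u\<in>dual_code n V. u \<bullet> x \<noteq> 0"
proof -
  \<comment> \<open>Finiteness of the ambient space supplies a maximal member of \<open>?S\<close>
    above \<open>V\<close>; this replaces extending a basis.\<close>
  let ?S = "{U. linear_code n U \<and> V \<subseteq> U \<and> x \<notin> U}"
  have "?S \<subseteq> Pow (carrier_vec n)" by (auto simp: linear_code_iff)
  then have "finite ?S" using finite_carrier_vec finite_subset by blast
  then obtain U where U: "U \<in> ?S" and max: "\<And>U'. U' \<in> ?S \<Longrightarrow> U \<subseteq> U' \<Longrightarrow> U = U'"
    using finite_has_maximal2[of ?S V] V x by auto
  have Ucar: "U \<subseteq> carrier_vec n" and Uzero: "0\<^sub>v n \<in> U"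
    and Uadd: "\<And>u v. u \<in> U \<Longrightarrow> v \<in> U \<Longrightarrow> u + v \<in> U"
    and Usmult: "\<And>a v. v \<in> U \<Longrightarrow> a \<cdot>\<^sub>v v \<in> U"
    and VU: "V \<subseteq> U" and xU: "x \<notin> U" and Ucode: "linear_code n U"
    using U by (auto simp: linear_code_iff)
  \<comment> \<open>Modulo \<open>U\<close> every \<open>y\<close> is a multiple of
    \<open>x\<close>: for \<open>y\<close> outside \<open>U\<close>, maximality puts
    \<open>x\<close> into the span \<open>?U'\<close> of \<open>U\<close> and \<open>y\<close>, say
    \<open>x = u + b y\<close>. Since \<open>x\<close> is not in \<open>U\<close>, \<open>b\<close>
    is non-zero and the equation can be solved for \<open>y\<close>.\<close>
  have *: "\<exists>a. y - a \<cdot>\<^sub>v x \<in> U" if y: "y \<in> carrier_vec n" for y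
  proof (cases "y \<in> U")
    case True
    moreover have "y - 0 \<cdot>\<^sub>v x = y" using x y by (intro eq_vecI) auto
    ultimately show ?thesis by metis
  next
    case False
    let ?U' = "{u + b \<cdot>\<^sub>v y | u b. u \<in> U}"
    have "linear_code n ?U'"
      unfolding linear_code_iff
    proof (intro conjI ballI allI)
      show "?U' \<subseteq> carrier_vec n" using Ucar y by auto
      have "0\<^sub>v n = 0\<^sub>v n + 0 \<cdot>\<^sub>v y" using y by (intro eq_vecI) auto
      then show "0\<^sub>v n \<in> ?U'" using Uzero by blast
    next
      fix p q assume "p \<in> ?U'" "q \<in> ?U'"
      then obtain u b v c where p: "p = u + b \<cdot>\<^sub>v y" "u \<in> U" and q: "q = v + c \<cdot>\<^sub>v y" "v \<in> U"
        by blast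
      have "p + q = (u + v) + (b + c) \<cdot>\<^sub>v y"
        using p q Ucar y by (intro eq_vecI) (auto simp: algebra_simps)
      then show "p + q \<in> ?U'" using Uadd p q by blast
    next
      fix a p assume "p \<in> ?U'"
      then obtain u b where p: "p = u + b \<cdot>\<^sub>v y" "u \<in> U" by blast
      have "a \<cdot>\<^sub>v p = a \<cdot>\<^sub>v u + (a * b) \<cdot>\<^sub>v y"
        using p Ucar y by (intro eq_vecI) (auto simp: algebra_simps)
      then show "a \<cdot>\<^sub>v p \<in> ?U'" using Usmult p by blast
    qed
    moreover have UU': "U \<subseteq> ?U'"
    proof
      fix u assume "u \<in> U"
      moreover have "u = u + 0 \<cdot>\<^sub>v y" using \<open>u \<in> U\<close> Ucar y by (intro eq_vecI) auto
      ultimately show "u \<in> ?U'" by blast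
    qed
    moreover have "y \<in> ?U'"
    proof -
      have "y = 0\<^sub>v n + 1 \<cdot>\<^sub>v y" using y by (intro eq_vecI) auto
      then show ?thesis using Uzero by blast
    qed
    ultimately have "x \<in> ?U'" using max[of ?U'] VU False by blast
    then obtain u b where xu: "x = u + b \<cdot>\<^sub>v y" "u \<in> U" by blast
    have "b \<noteq> 0"
    proof
      assume "b = 0"
      then have "x = u" using xu Ucar y by (intro eq_vecI) auto
      then show False using xu xU by simp
    qed
    then have "y - inverse b \<cdot>\<^sub>v x = (- inverse b) \<cdot>\<^sub>v u"
      using xu Ucar y by (intro eq_vecI) (auto simp: field_simps)
    then show ?thesis using Usmult xu(2) by metis
  qed
  \<comment> \<open>\<open>f i\<close> is the coordinate of the \<open>i\<close>-th unit vector
    along \<open>x\<close> modulo \<open>U\<close>, so the scalar product with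
    \<open>vec n f\<close> gives the coordinate of any vector by linearity.\<close>
  define f where "f i = (SOME a. unit_vec n i - a \<cdot>\<^sub>v x \<in> U)" for i
  have f: "unit_vec n i - f i \<cdot>\<^sub>v x \<in> U" for i
    unfolding f_def using *[of "unit_vec n i"] by (auto intro: someI_ex)
  have main: "y - (vec n f \<bullet> y) \<cdot>\<^sub>v x \<in> U" if y: "y \<in> carrier_vec n" for y
  proof -
    \<comment> \<open>Linearity is obtained by adding one coordinate of \<open>y\<close> at a time:
      the truncation of \<open>y\<close> to its first \<open>m\<close> entries is the partial sum of
      its unit-vector expansion.\<close>
    have "vec n (\<lambda>i. if i < m then y $ i else 0) - (\<Sum>i<m. f i * y $ i) \<cdot>\<^sub>v x \<in> U" if "m \<le> n" for m
      using that
    proof (induction m)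
      case 0
      have "vec n (\<lambda>i. if i < 0 then y $ i else 0) - (\<Sum>i<0. f i * y $ i) \<cdot>\<^sub>v x = 0\<^sub>v n"
        using x by (intro eq_vecI) auto
      then show ?case using Uzero by simp
    next
      case (Suc m)
      have "vec n (\<lambda>i. if i < Suc m then y $ i else 0) - (\<Sum>i<Suc m. f i * y $ i) \<cdot>\<^sub>v x
        = (vec n (\<lambda>i. if i < m then y $ i else 0) - (\<Sum>i<m. f i * y $ i) \<cdot>\<^sub>v x)
          + y $ m \<cdot>\<^sub>v (unit_vec n m - f m \<cdot>\<^sub>v x)"
        using x Suc.prems by (intro eq_vecI) (auto simp: algebra_simps less_Suc_eq)
      then show ?case using Uadd Usmult f Suc by simp
    qed
    from this[of n] have "vec n (\<lambda>i. if i < n then y $ i else 0) - (\<Sum>i<n. f i * y $ i) \<cdot>\<^sub>v x \<in> U"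
      by simp
    moreover have "vec n (\<lambda>i. if i < n then y $ i else 0) = y" using y by (intro eq_vecI) auto
    moreover have "(\<Sum>i<n. f i * y $ i) = vec n f \<bullet> y"
      using y by (auto simp: scalar_prod_def lessThan_atLeast0)
    ultimately show ?thesis by simp
  qed
  have xmult: "a = 0" if "a \<cdot>\<^sub>v x \<in> U" for a
  proof (rule ccontr)
    assume "a \<noteq> 0"
    then have "inverse a \<cdot>\<^sub>v (a \<cdot>\<^sub>v x) = x" using x by (intro eq_vecI) auto
    then show False using Usmult[OF that, of "inverse a"] xU by simp
  qed
  have "vec n f \<bullet> v = 0" if "v \<in> V" for v
  proof -
    have v: "v \<in> U" "v \<in> carrier_vec n" using that VU Ucar by auto
    \<comment> \<open>Both \<open>v\<close> and its projection along \<open>x\<close> lie in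
      \<open>U\<close>, hence so does the multiple of \<open>x\<close> by which they differ;
      \<open>xmult\<close> makes that multiple zero.\<close>
    have "v - (v - (vec n f \<bullet> v) \<cdot>\<^sub>v x) \<in> U"
      using linear_code_minus[OF Ucode v(1) main[OF v(2)]] .
    moreover have "v - (v - (vec n f \<bullet> v) \<cdot>\<^sub>v x) = (vec n f \<bullet> v) \<cdot>\<^sub>v x"
      using v x by (intro eq_vecI) auto
    ultimately show ?thesis using xmult by simp
  qed
  moreover have "vec n f \<bullet> x \<noteq> 0"
  proof
    assume "vec n f \<bullet> x = 0"
    moreover have "x - 0 \<cdot>\<^sub>v x = x" using x by (intro eq_vecI) auto
    ultimately show False using main[OF x(1)] xU by simp
  qed
  ultimately show ?thesis unfolding dual_code_def by (intro bexI[of _ "vec n f"]) auto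
qed

text \<open>A vector outside \<open>C\<close> is detected by some vector of the dual, so it cannot
  be orthogonal to the whole dual; the other inclusion is symmetry of the scalar product.\<close>

lemma dual_code_dual_code:
  fixes C :: "'a::{field,finite} vec set"
  assumes C: "linear_code n C"
  shows "dual_code n (dual_code n C) = C"
proof
  show "dual_code n (dual_code n C) \<subseteq> C"
  proof
    fix x assume x: "x \<in> dual_code n (dual_code n C)"
    show "x \<in> C"
    proof (rule ccontr)
      assume "x \<notin> C"
      then obtain u where u: "u \<in> dual_code n C" "u \<bullet> x \<noteq> 0"
        using dual_code_separates[OF C] x unfolding dual_code_def by blast
      then have "x \<bullet> u = 0" "x \<in> carrier_vec n" "u \<in> carrier_vec n"
        using x unfolding dual_code_def by auto
      then show False using u by (simp add: comm_scalar_prod[of x n u])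
    qed
  qed
  have "c \<bullet> u = 0" if "c \<in> C" "u \<in> dual_code n C" for c u
    using that C comm_scalar_prod[of c n u] unfolding dual_code_def linear_code_iff by auto
  then show "C \<subseteq> dual_code n (dual_code n C)"
    using C unfolding dual_code_def[of n "dual_code n C"] linear_code_iff by auto
qed

section \<open>Weights and restrictions\<close>

text \<open>The strict bound is turned into \<open>\<le>\<close> on the successor, which passes
  through the infimum. On the empty set both sides are true.\<close>

lemma enat_less_min_weight_iff: "enat t < min_weight S \<longleftrightarrow> (\<forall>v\<in>S. t < wt v)"
proof -
  have "enat t < min_weight S \<longleftrightarrow> enat (Suc t) \<le> min_weight S" by (simp add: Suc_ile_eq)
  also have "\<dots> \<longleftrightarrow> (\<forall>v\<in>S. Suc t \<le> wt v)" by (simp add: min_weight_def le_INF_iff)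
  finally show ?thesis by (simp add: Suc_le_eq)
qed

lemma wt_minus_le:
  fixes u v :: "'a::group_add vec"
  assumes "u \<in> carrier_vec n" "v \<in> carrier_vec n"
  shows "wt (u - v) \<le> wt u + wt v"
proof -
  have "{i. i < dim_vec (u - v) \<and> (u - v) $ i \<noteq> 0} \<subseteq>
    {i. i < dim_vec u \<and> u $ i \<noteq> 0} \<union> {i. i < dim_vec v \<and> v $ i \<noteq> 0}"
    using assms by auto
  then have "wt (u - v) \<le> card ({i. i < dim_vec u \<and> u $ i \<noteq> 0} \<union> {i. i < dim_vec v \<and> v $ i \<noteq> 0})"
    unfolding wt_def by (intro card_mono) auto
  also have "\<dots> \<le> wt u + wt v" unfolding wt_def by (rule card_Un_le)
  finally show ?thesis .
qed

lemma wt_le_card: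
  assumes "finite J" "\<And>i. i < dim_vec u \<Longrightarrow> u $ i \<noteq> 0 \<Longrightarrow> i \<in> J"
  shows "wt u \<le> card J"
  unfolding wt_def using assms by (intro card_mono) auto

text \<open>Converse of the triangle inequality \<open>wt_minus_le\<close>: distribute the support
  of \<open>v\<close> over two vectors, filling the first with as many positions as \<open>a\<close>
  allows.\<close>

lemma wt_le_add_split:
  fixes v :: "'a::group_add vec"
  assumes v: "v \<in> carrier_vec n" and "wt v \<le> a + b"
  shows "\<exists>y\<in>carrier_vec n. \<exists>z\<in>carrier_vec n. v = y - z \<and> wt y \<le> a \<and> wt z \<le> b"
proof -
  let ?S = "{i. i < dim_vec v \<and> v $ i \<noteq> 0}"
  obtain T where T: "T \<subseteq> ?S" "card T = min a (card ?S)"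
    using obtain_subset_with_card_n[of "min a (card ?S)" ?S] by auto
  have fin: "finite ?S" by simp
  have card: "card (?S - T) \<le> b"
    using assms(2) T by (auto simp: card_Diff_subset finite_subset[OF T(1) fin] wt_def)
  let ?y = "vec n (\<lambda>i. if i \<in> T then v $ i else 0)"
  let ?z = "vec n (\<lambda>i. if i \<in> T then 0 else - v $ i)"
  have "v = ?y - ?z" using v by (intro eq_vecI) auto
  moreover have "wt ?y \<le> a"
    using wt_le_card[of T ?y] finite_subset[OF T(1) fin] T(2) by (fastforce split: if_splits)
  moreover have "wt ?z \<le> b"
    using wt_le_card[of "?S - T" ?z] v card by (fastforce split: if_splits)
  moreover have "?y \<in> carrier_vec n" "?z \<in> carrier_vec n" by auto
  ultimately show ?thesis by blast
qed

text \<open>Restriction to \<open>I\<close> realised as a projection within \<open>F^n\<close>, so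
  that dual codes and scalar products of length \<open>n\<close> still apply.\<close>

definition mask_vec :: "nat \<Rightarrow> nat set \<Rightarrow> 'a::zero vec \<Rightarrow> 'a vec" where
  "mask_vec n I v = vec n (\<lambda>i. if i \<in> I then v $ i else 0)"

lemma mask_vec_carrier [simp]: "mask_vec n I v \<in> carrier_vec n"
  by (simp add: mask_vec_def)

text \<open>Masking is self-adjoint. This converts a functional on restricted vectors into a vector
  supported on \<open>I\<close>.\<close>

lemma scalar_prod_mask_vec:
  fixes u v :: "'a::comm_semiring_0 vec"
  assumes "v \<in> carrier_vec n" "u \<in> carrier_vec n"
  shows "mask_vec n I u \<bullet> v = u \<bullet> mask_vec n I v"
  using assms by (auto simp: mask_vec_def scalar_prod_def intro!: sum.cong)

lemma wt_mask_vec_le: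
  assumes "finite I"
  shows "wt (mask_vec n I u) \<le> card I"
proof (rule wt_le_card[OF assms])
  fix i assume "i < dim_vec (mask_vec n I u)" "mask_vec n I u $ i \<noteq> 0"
  then show "i \<in> I" by (cases "i \<in> I") (simp_all add: mask_vec_def)
qed

lemma linear_code_mask_vec:
  fixes V :: "'a::field vec set"
  assumes "linear_code n V"
  shows "linear_code n (mask_vec n I ` V)"
  unfolding linear_code_iff
proof (intro conjI ballI allI)
  have V: "V \<subseteq> carrier_vec n" "0\<^sub>v n \<in> V" "\<And>u v. u \<in> V \<Longrightarrow> v \<in> V \<Longrightarrow> u + v \<in> V"
    "\<And>a v. v \<in> V \<Longrightarrow> a \<cdot>\<^sub>v v \<in> V"
    using assms by (auto simp: linear_code_iff)
  show "mask_vec n I ` V \<subseteq> carrier_vec n" by auto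
  have "mask_vec n I (0\<^sub>v n) = (0\<^sub>v n :: 'a vec)" by (auto simp: mask_vec_def)
  then show "0\<^sub>v n \<in> mask_vec n I ` V" using V(2) by (metis imageI)
  show "x + y \<in> mask_vec n I ` V" if xy: "x \<in> mask_vec n I ` V" "y \<in> mask_vec n I ` V" for x y
  proof -
    obtain u v where uv: "x = mask_vec n I u" "y = mask_vec n I v" "u \<in> V" "v \<in> V" using xy by blast
    then have "x + y = mask_vec n I (u + v)"
      using V(1) by (intro eq_vecI) (auto simp: mask_vec_def)
    then show ?thesis using uv V(3) by blast
  qed
  show "a \<cdot>\<^sub>v x \<in> mask_vec n I ` V" if xV: "x \<in> mask_vec n I ` V" for a x
  proof -
    obtain u where u: "x = mask_vec n I u" "u \<in> V" using xV by blast
    then have "a \<cdot>\<^sub>v x = mask_vec n I (a \<cdot>\<^sub>v u)"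
      using V(1) by (intro eq_vecI) (auto simp: mask_vec_def)
    then show ?thesis using u V(4) by blast
  qed
qed

section \<open>Randomized coset encodings\<close>

lemma prob_pmf_eq_1_iff: "measure_pmf.prob p S = 1 \<longleftrightarrow> set_pmf p \<subseteq> S"
  by (subst measure_pmf.prob_eq_1) (auto simp: AE_measure_pmf_iff)

text \<open>\<open>A\<close> is the message block and \<open>B\<close> the randomness block of a
  generator matrix. The last assumption says that \<open>A\<close> is injective with image meeting
  that of \<open>B\<close> only in zero, so distinct messages have disjoint cosets.\<close>

locale coset_encoding =
  fixes n k' l :: nat and A B :: "'a::{field,finite} mat" and Enc :: "'a vec \<Rightarrow> 'a vec pmf"
  assumes A: "A \<in> carrier_mat n k'" and B: "B \<in> carrier_mat n l"
    and Enc_eq: "m \<in> carrier_vec k' \<Longrightarrow>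
      Enc m = map_pmf (\<lambda>r. A *\<^sub>v m + B *\<^sub>v r) (pmf_of_set (carrier_vec l))"
    and coset_inj: "m \<in> carrier_vec k' \<Longrightarrow> r \<in> carrier_vec l \<Longrightarrow> A *\<^sub>v m = B *\<^sub>v r \<Longrightarrow> m = 0\<^sub>v k'"
begin

text \<open>In the application this is \<open>dual_code n C\<^sub>Z\<close>, and
  \<open>full_code\<close> below is \<open>C\<^sub>X\<close>.\<close>

definition noise_code :: "'a vec set" where
  "noise_code = {B *\<^sub>v r | r. r \<in> carrier_vec l}"

definition full_code :: "'a vec set" where
  "full_code = {A *\<^sub>v m + B *\<^sub>v r | m r. m \<in> carrier_vec k' \<and> r \<in> carrier_vec l}"

lemma dims [simp]: "dim_row A = n" "dim_col A = k'" "dim_row B = n" "dim_col B = l"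
  using A B by auto

lemma mult_vec_carrier [simp]: "A *\<^sub>v m \<in> carrier_vec n" "B *\<^sub>v r \<in> carrier_vec n"
  by (rule carrier_vecI, simp)+

lemma carrier_vec_l_ne: "(carrier_vec l :: 'a vec set) \<noteq> {}"
  using zero_carrier_vec by blast

lemma set_pmf_Enc:
  assumes "m \<in> carrier_vec k'"
  shows "set_pmf (Enc m) = {A *\<^sub>v m + B *\<^sub>v r | r. r \<in> carrier_vec l}"
proof -
  have "set_pmf (pmf_of_set (carrier_vec l :: 'a vec set)) = carrier_vec l"
    by (rule set_pmf_of_set[OF carrier_vec_l_ne finite_carrier_vec])
  then show ?thesis unfolding Enc_eq[OF assms] set_map_pmf by blast
qed

lemma A_zero [simp]: "A *\<^sub>v 0\<^sub>v k' = 0\<^sub>v n" and B_zero [simp]: "B *\<^sub>v 0\<^sub>v l = 0\<^sub>v n"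
  using row_carrier_vec[OF _ A] row_carrier_vec[OF _ B] by (intro eq_vecI; simp)+

lemma set_pmf_Enc_zero: "set_pmf (Enc (0\<^sub>v k')) = noise_code"
proof -
  have "0\<^sub>v n + B *\<^sub>v r = B *\<^sub>v r" for r by (simp add: left_zero_vec[of _ n])
  then show ?thesis by (simp add: set_pmf_Enc noise_code_def)
qed

lemma diff_encodings:
  assumes "m \<in> carrier_vec k'" "m' \<in> carrier_vec k'" "r \<in> carrier_vec l" "r' \<in> carrier_vec l"
  shows "(A *\<^sub>v m + B *\<^sub>v r) - (A *\<^sub>v m' + B *\<^sub>v r') = A *\<^sub>v (m - m') + B *\<^sub>v (r - r')"
proof -
  have "A *\<^sub>v (m - m') = A *\<^sub>v m - A *\<^sub>v m'" "B *\<^sub>v (r - r') = B *\<^sub>v r - B *\<^sub>v r'"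
    using assms mult_minus_distrib_mat_vec[OF A] mult_minus_distrib_mat_vec[OF B] by auto
  then show ?thesis by (intro eq_vecI) auto
qed

text \<open>From \<open>A m + B r = B s\<close> one gets \<open>A m = B (s - r)\<close>, to which
  \<open>coset_inj\<close> applies.\<close>

lemma encoding_in_noise_code:
  assumes "m \<in> carrier_vec k'" "r \<in> carrier_vec l" "A *\<^sub>v m + B *\<^sub>v r \<in> noise_code"
  shows "m = 0\<^sub>v k'"
proof -
  obtain s where s: "s \<in> carrier_vec l" "A *\<^sub>v m + B *\<^sub>v r = B *\<^sub>v s"
    using assms(3) unfolding noise_code_def by blast
  have "A *\<^sub>v m = (A *\<^sub>v m + B *\<^sub>v r) - B *\<^sub>v r" by (intro eq_vecI) auto
  also have "\<dots> = B *\<^sub>v (s - r)" unfolding s(2)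
    using s assms mult_minus_distrib_mat_vec[OF B] by metis
  finally show ?thesis using coset_inj[of m "s - r"] assms(1,2) s(1) by auto
qed

lemma linear_code_noise_code: "linear_code n noise_code"
  unfolding linear_code_iff
proof (intro conjI ballI allI)
  show "noise_code \<subseteq> carrier_vec n" by (auto simp: noise_code_def)
  show "0\<^sub>v n \<in> noise_code" using B_zero unfolding noise_code_def
    by (metis (mono_tags, lifting) mem_Collect_eq zero_carrier_vec)
  show "u + v \<in> noise_code" if uv: "u \<in> noise_code" "v \<in> noise_code" for u v
  proof -
    obtain r s where "u = B *\<^sub>v r" "v = B *\<^sub>v s" "r \<in> carrier_vec l" "s \<in> carrier_vec l"
      using uv unfolding noise_code_def by blast
    then have "u + v = B *\<^sub>v (r + s)" "r + s \<in> carrier_vec l"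
      using mult_add_distrib_mat_vec[OF B] by auto
    then show ?thesis unfolding noise_code_def by blast
  qed
  show "a \<cdot>\<^sub>v v \<in> noise_code" if v: "v \<in> noise_code" for a v
  proof -
    obtain r where "v = B *\<^sub>v r" "r \<in> carrier_vec l"
      using v unfolding noise_code_def by blast
    then have "a \<cdot>\<^sub>v v = B *\<^sub>v (a \<cdot>\<^sub>v r)" "a \<cdot>\<^sub>v r \<in> carrier_vec l"
      using mult_mat_vec[OF B] by auto
    then show ?thesis unfolding noise_code_def by blast
  qed
qed

text \<open>Decode to the message having an encoding within distance \<open>e\<close>. Two
  candidates would yield encodings differing by weight at most \<open>2 * e\<close>; such a
  difference lies in \<open>noise_code\<close>, so the messages coincide.\<close>

lemma decodable_if_distance:
  assumes dist: "\<And>c. c \<in> full_code - noise_code \<Longrightarrow> 2 * e < wt c"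
  shows "decodable n k' e Enc"
proof -
  define P where "P w m \<longleftrightarrow> m \<in> carrier_vec k' \<and>
    (\<exists>r\<in>carrier_vec l. \<exists>y\<in>carrier_vec n. wt y \<le> e \<and> w = (A *\<^sub>v m + B *\<^sub>v r) + y)" for w m
  have unique: "m = m'" if mm': "P w m" "P w m'" for w m m'
  proof -
    obtain r y r' y' where m: "m \<in> carrier_vec k'" "r \<in> carrier_vec l" "y \<in> carrier_vec n"
        "wt y \<le> e" "w = (A *\<^sub>v m + B *\<^sub>v r) + y"
      and m': "m' \<in> carrier_vec k'" "r' \<in> carrier_vec l" "y' \<in> carrier_vec n"
        "wt y' \<le> e" "w = (A *\<^sub>v m' + B *\<^sub>v r') + y'"
      using mm' unfolding P_def by blast
    let ?c = "A *\<^sub>v (m - m') + B *\<^sub>v (r - r')"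
    have eq: "(A *\<^sub>v m + B *\<^sub>v r) + y = (A *\<^sub>v m' + B *\<^sub>v r') + y'" using m m' by simp
    have "?c = (A *\<^sub>v m + B *\<^sub>v r) - (A *\<^sub>v m' + B *\<^sub>v r')"
      using diff_encodings m m' by metis
    also have "\<dots> = y' - y"
    proof (intro eq_vecI)
      fix i assume "i < dim_vec (y' - y)"
      then have i: "i < n" using m by auto
      have "((A *\<^sub>v m + B *\<^sub>v r) + y) $ i = ((A *\<^sub>v m' + B *\<^sub>v r') + y') $ i" using eq by simp
      then show "((A *\<^sub>v m + B *\<^sub>v r) - (A *\<^sub>v m' + B *\<^sub>v r')) $ i = (y' - y) $ i"
        using i m(3) m'(3) by (simp add: algebra_simps del: index_mult_mat_vec)
    qed (use m m' in auto)
    finally have "wt ?c \<le> 2 * e"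
      using wt_minus_le[of y' n y] m m' by simp
    moreover have "?c \<in> full_code"
      unfolding full_code_def using minus_carrier_vec[OF m(1) m'(1)] minus_carrier_vec[OF m(2) m'(2)]
      by blast
    ultimately have "?c \<in> noise_code" using dist linorder_not_less by blast
    then have zero: "m - m' = 0\<^sub>v k'"
      by (rule encoding_in_noise_code[OF minus_carrier_vec[OF m(1) m'(1)] minus_carrier_vec[OF m(2) m'(2)]])
    show ?thesis
    proof (rule eq_vecI)
      fix i assume "i < dim_vec m'"
      then have "i < k'" using m'(1) by simp
      then have "(m - m') $ i = 0" using zero by simp
      then show "m $ i = m' $ i" using \<open>i < k'\<close> m'(1) by simp
    qed (use m(1) m'(1) in simp)
  qed
  \<comment> \<open>The value \<open>0\<^sub>v k'\<close> on words too far from every encoding is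
    arbitrary; it keeps \<open>D\<close> inside the message space.\<close>
  define D where "D w = (if \<exists>m. P w m then THE m. P w m else 0\<^sub>v k')" for w
  have D: "D w = m" if "P w m" for w m
    unfolding D_def using that unique by auto
  have "D \<in> carrier_vec n \<rightarrow> carrier_vec k'"
  proof
    fix w :: "'a vec"
    show "D w \<in> carrier_vec k'"
    proof (cases "\<exists>m. P w m")
      case True
      then obtain m where "P w m" by blast
      then show ?thesis using D P_def by metis
    next
      case False
      then show ?thesis by (simp add: D_def)
    qed
  qed
  moreover have "measure_pmf.prob (Enc m) {c. D (c + y) = m} = 1"
    if "m \<in> carrier_vec k'" "y \<in> carrier_vec n" "wt y \<le> e" for m y
  proof -
    have "D (A *\<^sub>v m + B *\<^sub>v r + y) = m" if "r \<in> carrier_vec l" for r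
      by (rule D) (use \<open>m \<in> _\<close> \<open>y \<in> _\<close> \<open>wt y \<le> e\<close> that P_def in blast)
    then show ?thesis unfolding prob_pmf_eq_1_iff set_pmf_Enc[OF that(1)] by blast
  qed
  ultimately show ?thesis unfolding decodable_def by blast
qed

text \<open>A violating \<open>c\<close> splits as \<open>y - z\<close> with both weights at most
  \<open>e\<close>. Then \<open>c\<close> with error \<open>z\<close> and the zero word with error
  \<open>y\<close> are the same received word, although \<open>c\<close> encodes a non-zero message
  and the zero word encodes zero.\<close>

lemma distance_if_decodable:
  assumes dec: "decodable n k' e Enc" and c: "c \<in> full_code - noise_code"
  shows "2 * e < wt c"
proof (rule ccontr)
  assume "\<not> 2 * e < wt c"
  then have "wt c \<le> e + e" by simp
  moreover have cn: "c \<in> carrier_vec n" using c unfolding full_code_def by auto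
  ultimately obtain y z where yz: "y \<in> carrier_vec n" "z \<in> carrier_vec n" "c = y - z"
      "wt y \<le> e" "wt z \<le> e"
    using wt_le_add_split by blast
  obtain m r where m: "m \<in> carrier_vec k'" "r \<in> carrier_vec l" "c = A *\<^sub>v m + B *\<^sub>v r"
    using c unfolding full_code_def by blast
  obtain D where D: "\<And>m y c. m \<in> carrier_vec k' \<Longrightarrow> y \<in> carrier_vec n \<Longrightarrow> wt y \<le> e \<Longrightarrow>
      c \<in> set_pmf (Enc m) \<Longrightarrow> D (c + y) = m"
    using dec unfolding decodable_def prob_pmf_eq_1_iff by blast
  have "c \<in> set_pmf (Enc m)" using m set_pmf_Enc by blast
  then have "D (c + z) = m" using D m yz by blast
  moreover have "0\<^sub>v n \<in> set_pmf (Enc (0\<^sub>v k'))"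
    using linear_code_noise_code by (simp add: set_pmf_Enc_zero linear_code_iff)
  then have "D (0\<^sub>v n + y) = 0\<^sub>v k'"
    using D[of "0\<^sub>v k'" y "0\<^sub>v n"] yz(1,4) zero_carrier_vec by blast
  moreover have "c + z = 0\<^sub>v n + y" using yz by (intro eq_vecI) auto
  ultimately have "m = 0\<^sub>v k'" by simp
  then have "c \<in> noise_code" using m set_pmf_Enc_zero set_pmf_Enc by blast
  then show False using c by blast
qed

text \<open>If \<open>A (m - m')\<close> agrees on \<open>I\<close> with some \<open>B r0\<close>,
  translating the randomness by \<open>r0\<close> carries the view of \<open>m\<close> to that of
  \<open>m'\<close> and preserves the uniform distribution. The distance bound guarantees such an
  \<open>r0\<close>.\<close>

lemma zero_knowledge_if_dual_distance:
  assumes dist: "\<And>u. u \<in> dual_code n noise_code - dual_code n full_code \<Longrightarrow> t < wt u"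
  shows "zero_knowledge n k' t Enc"
  unfolding zero_knowledge_def
proof (intro allI impI ballI)
  fix I and m m' :: "'a vec"
  assume I: "I \<subseteq> {..<n} \<and> card I = t" and m: "m \<in> carrier_vec k'" and m': "m' \<in> carrier_vec k'"
  let ?d = "A *\<^sub>v (m - m')"
  have fin: "finite I" using I finite_subset by blast
  have "mask_vec n I ?d \<in> mask_vec n I ` noise_code"
  proof (rule ccontr)
    assume "mask_vec n I ?d \<notin> mask_vec n I ` noise_code"
    \<comment> \<open>Masking the separating \<open>u\<close> gives a vector of weight at most
      \<open>t\<close> that is orthogonal to \<open>noise_code\<close> but not to \<open>?d\<close>,
      which belongs to \<open>full_code\<close>.\<close>
    then obtain u where u: "u \<in> dual_code n (mask_vec n I ` noise_code)" "u \<bullet> mask_vec n I ?d \<noteq> 0"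
      using dual_code_separates[OF linear_code_mask_vec[OF linear_code_noise_code]]
      by (meson mask_vec_carrier)
    have un: "u \<in> carrier_vec n" using u by (simp add: dual_code_def)
    have "mask_vec n I u \<in> dual_code n noise_code"
      using u un linear_code_noise_code unfolding dual_code_def linear_code_iff
      by (auto simp: scalar_prod_mask_vec subset_iff)
    moreover have "?d \<in> full_code"
    proof -
      have "?d = ?d + B *\<^sub>v 0\<^sub>v l" using right_zero_vec[of ?d n] by simp
      then show ?thesis unfolding full_code_def
        using m m' by (metis (mono_tags, lifting) mem_Collect_eq minus_carrier_vec zero_carrier_vec)
    qed
    moreover have "mask_vec n I u \<bullet> ?d \<noteq> 0" using u un by (simp add: scalar_prod_mask_vec)
    ultimately have "t < wt (mask_vec n I u)" using dist unfolding dual_code_def by blast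
    then show False using wt_mask_vec_le[OF fin, of n u] I by simp
  qed
  then obtain r0 where r0: "r0 \<in> carrier_vec l" "mask_vec n I ?d = mask_vec n I (B *\<^sub>v r0)"
    unfolding noise_code_def by blast
  have agree: "?d $ i = (B *\<^sub>v r0) $ i" if "i \<in> I" for i
  proof -
    have "i < n" using that I by auto
    moreover have "mask_vec n I ?d $ i = mask_vec n I (B *\<^sub>v r0) $ i" using r0 by simp
    ultimately show ?thesis using that by (simp add: mask_vec_def)
  qed
  have shift: "bij_betw (\<lambda>r. r + r0) (carrier_vec l) (carrier_vec l)"
  proof (rule bij_betw_byWitness[where f' = "\<lambda>r. r - r0"])
    show "\<forall>r\<in>carrier_vec l. r + r0 - r0 = r" "\<forall>r\<in>carrier_vec l. r - r0 + r0 = r"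
      using r0(1) by auto
  qed (use r0(1) in auto)
  let ?U = "pmf_of_set (carrier_vec l) :: 'a vec pmf"
  let ?res = "\<lambda>c :: 'a vec. restrict (\<lambda>i. c $ i) I"
  have "map_pmf ?res (Enc m) = map_pmf (\<lambda>r. ?res (A *\<^sub>v m + B *\<^sub>v r)) ?U"
    using m by (simp add: Enc_eq map_pmf_comp)
  \<comment> \<open>On \<open>I\<close>, \<open>A m + B r\<close> equals
    \<open>A m' + B (r + r0)\<close> by the choice of \<open>r0\<close>.\<close>
  also have "\<dots> = map_pmf (\<lambda>r. ?res (A *\<^sub>v m' + B *\<^sub>v (r + r0))) ?U"
  proof (rule map_pmf_cong[OF refl])
    fix r assume "r \<in> set_pmf ?U"
    then have r: "r \<in> carrier_vec l" by (simp add: carrier_vec_l_ne finite_carrier_vec)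
    have "(A *\<^sub>v m + B *\<^sub>v r) $ i = (A *\<^sub>v m' + B *\<^sub>v (r + r0)) $ i" if i: "i \<in> I" for i
    proof -
      have "i < n" using i I by auto
      moreover have "(A *\<^sub>v m) $ i = (A *\<^sub>v m') $ i + (B *\<^sub>v r0) $ i"
        using agree[OF i] \<open>i < n\<close> unfolding mult_minus_distrib_mat_vec[OF A m m']
        by (simp add: diff_eq_eq add.commute del: index_mult_mat_vec)
      ultimately show ?thesis
        unfolding mult_add_distrib_mat_vec[OF B r r0(1)]
        by (simp add: ac_simps del: index_mult_mat_vec)
    qed
    then show "?res (A *\<^sub>v m + B *\<^sub>v r) = ?res (A *\<^sub>v m' + B *\<^sub>v (r + r0))" by auto
  qed
  also have "\<dots> = map_pmf (\<lambda>r. ?res (A *\<^sub>v m' + B *\<^sub>v r)) (map_pmf (\<lambda>r. r + r0) ?U)"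
    by (simp add: map_pmf_comp)
  also have "map_pmf (\<lambda>r. r + r0) ?U = ?U"
    by (rule map_pmf_of_set_bij_betw[OF shift carrier_vec_l_ne finite_carrier_vec])
  also have "map_pmf (\<lambda>r. ?res (A *\<^sub>v m' + B *\<^sub>v r)) ?U = map_pmf ?res (Enc m')"
    using m' by (simp add: Enc_eq map_pmf_comp)
  finally show "map_pmf ?res (Enc m) = map_pmf ?res (Enc m')" .
qed

text \<open>If \<open>u\<close> had weight at most \<open>t\<close>, its product with a word would
  depend only on \<open>t\<close> coordinates. There a word \<open>c\<close> not orthogonal to
  \<open>u\<close> looks like some encoding of zero, which is orthogonal to
  \<open>u\<close>.\<close>

lemma dual_distance_if_zero_knowledge:
  assumes zk: "zero_knowledge n k' t Enc" and "t < n"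
    and u: "u \<in> dual_code n noise_code - dual_code n full_code"
  shows "t < wt u"
proof (rule ccontr)
  assume "\<not> t < wt u"
  have un: "u \<in> carrier_vec n" using u by (simp add: dual_code_def)
  let ?S = "{i. i < dim_vec u \<and> u $ i \<noteq> 0}"
  have "?S \<subseteq> {..<n}" using un by auto
  \<comment> \<open>The support of \<open>u\<close> is enlarged to exactly \<open>t\<close>
    positions, which \<open>t < n\<close> allows.\<close>
  then obtain I where I: "?S \<subseteq> I" "I \<subseteq> {..<n}" "card I = t"
    using exists_subset_between[of ?S t "{..<n}"] \<open>\<not> t < wt u\<close> \<open>t < n\<close> by (auto simp: wt_def)
  obtain c where c: "c \<in> full_code" "u \<bullet> c \<noteq> 0"
    using u un unfolding dual_code_def by blast
  then obtain m r where m: "m \<in> carrier_vec k'" "r \<in> carrier_vec l" "c = A *\<^sub>v m + B *\<^sub>v r"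
    unfolding full_code_def by blast
  let ?res = "\<lambda>c :: 'a vec. restrict (\<lambda>i. c $ i) I"
  have "map_pmf ?res (Enc m) = map_pmf ?res (Enc (0\<^sub>v k'))"
    using zk[unfolded zero_knowledge_def, rule_format, OF conjI[OF I(2,3)] m(1) zero_carrier_vec] .
  then have "set_pmf (map_pmf ?res (Enc m)) = set_pmf (map_pmf ?res (Enc (0\<^sub>v k')))" by simp
  moreover have "c \<in> set_pmf (Enc m)" using m set_pmf_Enc by blast
  ultimately have "?res c \<in> ?res ` noise_code"
    by (simp add: set_pmf_Enc_zero) blast
  then obtain w where w: "w \<in> noise_code" "?res c = ?res w" by blast
  have cn: "c \<in> carrier_vec n" and wn: "w \<in> carrier_vec n"
    using m(3) w(1) linear_code_noise_code by (auto simp: linear_code_iff)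
  \<comment> \<open>Inside \<open>I\<close> the words \<open>c\<close> and \<open>w\<close> agree;
    outside \<open>I\<close> the entry of \<open>u\<close> is zero.\<close>
  have "u $ i * c $ i = u $ i * w $ i" if "i < n" for i
    using fun_cong[OF w(2), of i] I(1) un that by (cases "i \<in> I") auto
  then have "u \<bullet> c = u \<bullet> w"
    using cn wn by (auto simp: scalar_prod_def intro!: sum.cong)
  moreover have "u \<bullet> w = 0" using u w by (simp add: dual_code_def)
  ultimately show False using c by simp
qed

end

section \<open>Generator matrices\<close>

lemma mat_of_cols_append_mult_vec:
  fixes xs ys :: "'a::comm_semiring_0 vec list"
  assumes "v \<in> carrier_vec (length xs)" "w \<in> carrier_vec (length ys)"
  shows "mat_of_cols n (xs @ ys) *\<^sub>v (v @\<^sub>v w) = mat_of_cols n xs *\<^sub>v v + mat_of_cols n ys *\<^sub>v w"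
proof (rule eq_vecI)
  fix i assume "i < dim_vec (mat_of_cols n xs *\<^sub>v v + mat_of_cols n ys *\<^sub>v w)"
  then have i: "i < n" by simp
  have "row (mat_of_cols n (xs @ ys)) i = row (mat_of_cols n xs) i @\<^sub>v row (mat_of_cols n ys) i"
    using i by (intro eq_vecI) (auto simp: mat_of_cols_def nth_append)
  then have "(mat_of_cols n (xs @ ys) *\<^sub>v (v @\<^sub>v w)) $ i =
      (row (mat_of_cols n xs) i @\<^sub>v row (mat_of_cols n ys) i) \<bullet> (v @\<^sub>v w)"
    using i by simp
  also have "\<dots> = row (mat_of_cols n xs) i \<bullet> v + row (mat_of_cols n ys) i \<bullet> w"
  proof (rule scalar_prod_append)
    show "row (mat_of_cols n xs) i \<in> carrier_vec (length xs)"
      "row (mat_of_cols n ys) i \<in> carrier_vec (length ys)"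
      using i by (simp_all add: row_carrier_vec[OF _ mat_of_cols_carrier(1)])
  qed (use assms in simp_all)
  also have "\<dots> = (mat_of_cols n xs *\<^sub>v v + mat_of_cols n ys *\<^sub>v w) $ i" using i by simp
  finally show "(mat_of_cols n (xs @ ys) *\<^sub>v (v @\<^sub>v w)) $ i =
      (mat_of_cols n xs *\<^sub>v v + mat_of_cols n ys *\<^sub>v w) $ i" .
qed simp

text \<open>Linear independence is a property of the set of columns and does not see repetitions.
  The rank is the size of a maximal independent subset of that set, so rank \<open>nc\<close> forces
  \<open>nc\<close> different columns.\<close>

lemma (in vec_space) full_rank_distinct_cols:
  assumes "M \<in> carrier_mat n nc" "rank M = nc"
  shows "distinct (cols M)"
proof -
  have len: "length (cols M) = nc" using assms(1) by simp
  obtain S where S: "finite S" "maximal S (\<lambda>T. T \<subseteq> set (cols M) \<and> lin_indpt T)"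
  proof -
    have "lin_indpt {}" by (rule finite_lin_indpt2) simp_all
    then show thesis
      using maximal_exists_superset[of "set (cols M)" "\<lambda>T. T \<subseteq> set (cols M) \<and> lin_indpt T" "{}"]
        that by blast
  qed
  have "nc = card S" using rank_card_indpt[OF assms(1) S(2)] assms(2) by simp
  also have "\<dots> \<le> card (set (cols M))"
    using S(2) by (intro card_mono) (auto simp: maximal_def)
  finally show ?thesis
    using card_length[of "cols M"] len by (intro card_distinct) simp
qed

lemma (in vec_space) full_rank_mult_vec_eq_0:
  assumes "M \<in> carrier_mat n nc" "rank M = nc" "v \<in> carrier_vec nc" "M *\<^sub>v v = 0\<^sub>v n"
  shows "v = 0\<^sub>v nc"
  using lin_depI[OF assms(1,3) _ assms(4)] full_rank_lin_indpt[OF assms(1,2)]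
    full_rank_distinct_cols[OF assms(1,2)] by blast

text \<open>The basis is taken inside \<open>code_space n W\<close>; spans there agree with spans in
  the ambient space, where they are column spaces.\<close>

lemma is_basis_list_mat_of_cols:
  fixes vs :: "'a::field vec list"
  assumes W: "linear_code n W" and basis: "is_basis_list n W vs"
  shows "W = {mat_of_cols n vs *\<^sub>v r | r. r \<in> carrier_vec (length vs)}"
proof -
  interpret vec_space "TYPE('a)" n .
  have sub: "submodule class_ring W V" and sp: "subspace class_ring W V"
    using W by (auto simp: linear_code_def subspace_def)
  interpret W: vectorspace class_ring "code_space n W"
    using subspace_is_vs[OF sp] .
  have vsW: "set vs \<subseteq> W" and gen: "W.span (set vs) = W"
    using basis unfolding is_basis_list_def W.basis_def by auto
  have vs: "set vs \<subseteq> carrier_vec n" using vsW W by (auto simp: linear_code_iff)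
  have "W = span (set vs)" using gen span_li_not_depend(1)[OF vsW sub] by simp
  also have "\<dots> = col_space (mat_of_cols n vs)"
    using vs by (simp add: col_space_def cols_mat_of_cols)
  also have "\<dots> = {mat_of_cols n vs *\<^sub>v r | r. r \<in> carrier_vec (length vs)}"
    using col_space_eq[OF mat_of_cols_carrier(1)] mult_mat_vec_carrier[OF mat_of_cols_carrier(1)]
    by (simp only: mat_of_cols_carrier) blast
  finally show ?thesis .
qed

section \<open>From the CSS code to a coset encoding\<close>

theorem corollary3p2:
  fixes C\<^sub>X C\<^sub>Z :: "'a::{field,finite} vec set"
    and G :: "'a mat"
    and n k k' :: nat
    and d\<^sub>X d\<^sub>Z :: enat
    and Enc :: "'a vec \<Rightarrow> 'a vec pmf"
  assumes "linear_code n C\<^sub>X" and "linear_code n C\<^sub>Z"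
    and "\<forall>c \<in> dual_code n C\<^sub>X. \<forall>c' \<in> dual_code n C\<^sub>Z. c \<bullet> c' = 0"
    and "k = code_dim n C\<^sub>X"
    and "k' = k - code_dim n (dual_code n C\<^sub>Z)"
    and "k' < k"
    and "generator_matrix n C\<^sub>X G"
    and "is_basis_list n (dual_code n C\<^sub>Z) (drop k' (cols G))"
    and "Enc = rand_enc k' G"
    and "d\<^sub>X = min_weight (C\<^sub>X - dual_code n C\<^sub>Z)"
    and "d\<^sub>Z = min_weight (C\<^sub>Z - dual_code n C\<^sub>X)"
  shows "(\<forall>e::nat. d\<^sub>X > enat (2 * e) \<longleftrightarrow> decodable n k' e Enc) \<and>
         (\<forall>t::nat. t < n \<longrightarrow> (d\<^sub>Z > enat t \<longleftrightarrow> zero_knowledge n k' t Enc))"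
proof -
  have GC: "G \<in> carrier_mat n k" "vec_space.rank n G = k" "vec_space.col_space n G = C\<^sub>X"
    using assms(4,7) by (auto simp: generator_matrix_def)
  have CZ: "C\<^sub>Z \<subseteq> carrier_vec n" using assms(2) by (simp add: linear_code_iff)
  define A where "A = mat_of_cols n (take k' (cols G))"
  define B where "B = mat_of_cols n (drop k' (cols G))"
  have len: "length (take k' (cols G)) = k'" "length (drop k' (cols G)) = k - k'"
    using GC(1) assms(6) by auto
  have A: "A \<in> carrier_mat n k'" and B: "B \<in> carrier_mat n (k - k')"
    using len unfolding A_def B_def by (metis mat_of_cols_carrier(1))+
  have split: "G *\<^sub>v (m @\<^sub>v r) = A *\<^sub>v m + B *\<^sub>v r"
    if "m \<in> carrier_vec k'" "r \<in> carrier_vec (k - k')" for m r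
  proof -
    have "G = mat_of_cols n (take k' (cols G) @ drop k' (cols G))"
      using GC(1) mat_of_cols_cols[of G] by simp
    then show ?thesis
      using mat_of_cols_append_mult_vec[of m "take k' (cols G)" r "drop k' (cols G)" n] that
      unfolding A_def B_def len by metis
  qed
  have carrier_vec_ne: "(carrier_vec (k - k') :: 'a vec set) \<noteq> {}"
    using zero_carrier_vec by blast
  interpret coset_encoding n k' "k - k'" A B Enc
  proof
    fix m :: "'a vec" assume m: "m \<in> carrier_vec k'"
    show "Enc m = map_pmf (\<lambda>r. A *\<^sub>v m + B *\<^sub>v r) (pmf_of_set (carrier_vec (k - k')))"
      unfolding assms(9) rand_enc_def
    proof (rule map_pmf_cong)
      show "pmf_of_set (carrier_vec (dim_col G - k')) = (pmf_of_set (carrier_vec (k - k')) :: 'a vec pmf)"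
        using GC(1) by simp
      fix r :: "'a vec" assume "r \<in> set_pmf (pmf_of_set (carrier_vec (k - k')))"
      then have "r \<in> carrier_vec (k - k')"
        using carrier_vec_ne by (simp add: finite_carrier_vec)
      then show "G *\<^sub>v (m @\<^sub>v r) = A *\<^sub>v m + B *\<^sub>v r" using split m by simp
    qed
    fix r :: "'a vec" assume r: "r \<in> carrier_vec (k - k')" and eq: "A *\<^sub>v m = B *\<^sub>v r"
    \<comment> \<open>The equation \<open>A m = B r\<close> makes \<open>(m, -r)\<close> a kernel
      vector of \<open>G\<close>, and full column rank forces it to vanish.\<close>
    have "B *\<^sub>v (- r) = - (B *\<^sub>v r)" using B r by (intro eq_vecI) auto
    then have "G *\<^sub>v (m @\<^sub>v - r) = 0\<^sub>v n"
      using split[OF m, of "- r"] r eq B by (auto intro!: eq_vecI)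
    moreover have "m @\<^sub>v - r \<in> carrier_vec k"
      using append_carrier_vec[OF m, of "- r" "k - k'"] r assms(6) by simp
    ultimately have "m @\<^sub>v - r = 0\<^sub>v k"
      using vec_space.full_rank_mult_vec_eq_0[OF GC(1,2)] by blast
    also have "0\<^sub>v k = 0\<^sub>v k' @\<^sub>v (0\<^sub>v (k - k') :: 'a vec)"
      using assms(6) by (intro eq_vecI) auto
    finally show "m = 0\<^sub>v k'" using append_vec_eq[OF m zero_carrier_vec] by blast
  qed (use A B in auto)
  have noise: "noise_code = dual_code n C\<^sub>Z"
    using is_basis_list_mat_of_cols[OF linear_code_dual_code[OF CZ] assms(8)]
    unfolding noise_code_def len B_def[symmetric] by (rule sym)
  have full: "full_code = C\<^sub>X"
  proof -
    have "C\<^sub>X = {y \<in> carrier_vec n. \<exists>z\<in>carrier_vec k. G *\<^sub>v z = y}"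
      using vec_space.col_space_eq[OF GC(1)] unfolding GC(3) carrier_matD[OF GC(1)] .
    also have "\<dots> = {G *\<^sub>v z | z. z \<in> carrier_vec k}"
      using mult_mat_vec_carrier[OF GC(1)] by blast
    also have "\<dots> = {G *\<^sub>v (m @\<^sub>v r) | m r. m \<in> carrier_vec k' \<and> r \<in> carrier_vec (k - k')}"
    proof -
      \<comment> \<open>With \<open>k' < k\<close> the truncated subtraction is exact, so each
        vector of length \<open>k\<close> is a message followed by randomness.\<close>
      have k: "k = k' + (k - k')" using assms(6) by simp
      have "\<exists>m r. z = m @\<^sub>v r \<and> m \<in> carrier_vec k' \<and> r \<in> carrier_vec (k - k')"
        if "z \<in> carrier_vec k" for z :: "'a vec"
        using vec_first_last_append[of z k' "k - k'"] that k
        by (metis vec_first_carrier vec_last_carrier)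
      moreover have "m @\<^sub>v r \<in> carrier_vec k"
        if "m \<in> carrier_vec k'" "r \<in> carrier_vec (k - k')" for m r :: "'a vec"
        using append_carrier_vec[OF that] k by simp
      ultimately show ?thesis by blast
    qed
    also have "\<dots> = full_code"
      unfolding full_code_def using split by (metis (no_types, opaque_lifting))
    finally show ?thesis by simp
  qed
  show ?thesis
  proof (intro conjI allI impI)
    show "enat (2 * e) < d\<^sub>X \<longleftrightarrow> decodable n k' e Enc" for e
      unfolding assms(10) enat_less_min_weight_iff noise[symmetric] full[symmetric]
      using decodable_if_distance distance_if_decodable by blast
    \<comment> \<open>The double dual identifies \<open>C\<^sub>Z\<close> with the dual of the noise
      code, so \<open>d\<^sub>Z\<close> is the distance appearing in the zero-knowledge
      lemmas.\<close>
    have dual: "dual_code n noise_code = C\<^sub>Z"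
      unfolding noise by (rule dual_code_dual_code[OF assms(2)])
    show "enat t < d\<^sub>Z \<longleftrightarrow> zero_knowledge n k' t Enc" if "t < n" for t
      unfolding assms(11) enat_less_min_weight_iff dual[symmetric] full[symmetric]
      using zero_knowledge_if_dual_distance dual_distance_if_zero_knowledge that by blast
  qed
qed

end
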